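(* Let $w\ge 4$ be an even integer, and set $u=w-2$, $v=w-1$. Then $$\sum_{\substack{a+c=w-1\\ a\ge 2,\ c\ge 1}}(-1)^a\,\zeta(a,1,c)=\zeta(u,2)-\zeta(v,1)+\frac12\zeta(w).$$
   Context: Multiple zeta values: for positive integers $s_1\ge2, s_2,\dots,s_d$, $\zeta(s_1,\dots,s_d)=\sum_{k_1>\cdots>k_d>0}k_1^{-s_1}\cdots k_d^{-s_d}$. The sum is over positive integers $a,c$. *)

theory Defs
  imports "HOL-Analysis.Infinite_Sum"
begin

text \<open>
  The terms are nonnegative, so the unordered sum agrees with the iterated series whenever
  the latter converges, in particular when all entries are positive and the first is at
  least 2; for a divergent argument \<^const>\<open>infsum\<close> returns 0.
\<close>

definition mzv :: "nat list \<Rightarrow> real" where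
  "mzv s = (\<Sum>\<^sub>\<infinity>k | length k = length s \<and> sorted_wrt (>) k \<and> (\<forall>n\<in>set k. 0 < n).
              \<Prod>i<length s. 1 / real (k ! i) ^ (s ! i))"

end

theory Submission
  imports Defs "HOL-Analysis.Summation_Tests"
begin

text \<open>
  Put \<open>q = w - 3\<close>. Summing the geometric progression in \<open>a\<close> turns the left-hand side into the sum over
  \<open>m > k > l > 0\<close> of \<open>1 / (k m (m + l) l^q) + 1 / (k m^(q+1) (m + l))\<close>. In the first part fix
  \<open>l = n\<close> and sum over \<open>m\<close>, then over \<open>k\<close>, by telescoping; in the second fix \<open>m = n\<close>, which leaves a
  finite sum. Both parts are then series over \<open>n\<close> of \<open>n^-(q+1)\<close> times a finite double sum, and
  the identity holds for each \<open>n\<close> separately; it rests on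
  \<open>(\<Sum>1\<le>p\<le>i\<le>n. 1 / (i (n + p))) = (\<Sum>k\<le>n. 1 / k^2) / 2\<close>.
\<close>

section \<open>Finite double sums of reciprocals\<close>

lemma sum_inverse_add_Suc:
  "(\<Sum>p=1..i. 1 / real (Suc n + p)) =
     (\<Sum>p=1..i. 1 / real (n + p)) + 1 / real (Suc n + i) - 1 / real (Suc n)"
  by (induction i) (simp_all add: add_ac)

text \<open>Induction on \<open>n\<close>. Raising \<open>n\<close> to \<open>N = Suc n\<close>
  shifts the window of each inner sum, and in the rows \<open>i <= n\<close> this costs exactly
  \<open>1 / (N (N + i))\<close>. The new row \<open>i = N\<close> contributes the terms
  \<open>1 / (N (N + p))\<close>, which cancel these losses except for \<open>p = N\<close>; what
  remains is \<open>1 / (2 N^2)\<close>.\<close>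

lemma sum_triangle_eq_half_sum_squares:
  "(\<Sum>i=1..n. 1 / real i * (\<Sum>p=1..i. 1 / real (n + p))) = (\<Sum>k=1..n. 1 / real k ^ 2) / 2"
proof (induction n)
  case (Suc n)
  let ?N = "real (Suc n)"
  have step: "1 / real i * (\<Sum>p=1..i. 1 / real (Suc n + p)) =
      1 / real i * (\<Sum>p=1..i. 1 / real (n + p)) - 1 / ?N * (1 / real (Suc n + i))"
    if "i \<in> {1..n}" for i
  proof -
    have "1 / real (Suc n + i) - 1 / ?N = - (real i / (?N * real (Suc n + i)))"
      by (simp add: field_simps)
    hence "1 / real i * (1 / real (Suc n + i) - 1 / ?N) = - (1 / ?N * (1 / real (Suc n + i)))"
      using that by simp
    thus ?thesis
      unfolding sum_inverse_add_Suc by (simp add: algebra_simps)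
  qed
  have "(\<Sum>i=1..Suc n. 1 / real i * (\<Sum>p=1..i. 1 / real (Suc n + p))) =
      (\<Sum>i=1..n. 1 / real i * (\<Sum>p=1..i. 1 / real (Suc n + p))) +
      1 / ?N * (\<Sum>p=1..Suc n. 1 / real (Suc n + p))"
    by simp
  also have "(\<Sum>i=1..n. 1 / real i * (\<Sum>p=1..i. 1 / real (Suc n + p))) =
      (\<Sum>i=1..n. 1 / real i * (\<Sum>p=1..i. 1 / real (n + p)))
        - 1 / ?N * (\<Sum>i=1..n. 1 / real (Suc n + i))"
    unfolding sum_distrib_left[of "1 / ?N"] sum_subtractf[symmetric]
    by (intro sum.cong refl step)
  also have "(\<Sum>p=1..Suc n. 1 / real (Suc n + p)) =
      (\<Sum>p=1..n. 1 / real (Suc n + p)) + 1 / (2 * ?N)"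
    by simp
  finally show ?case
    unfolding Suc.IH by (simp add: ring_distribs power2_eq_square add_divide_distrib)
qed auto

text \<open>Making the inequalities strict removes the diagonal terms
  \<open>1 / (k (n + k))\<close>, split by partial fractions, and the whole row
  \<open>i = n\<close>. The part of the diagonal with denominators \<open>n + k\<close> cancels that
  row up to its last entry, which leaves \<open>1 / (2 n^2)\<close>.\<close>

lemma sum_strict_triangle:
  assumes "n > 0"
  shows "(\<Sum>k=1..<n. 1 / real k * (\<Sum>l=1..<k. 1 / real (n + l))) =
    (\<Sum>i=1..n. 1 / real i * (\<Sum>p=1..i. 1 / real (n + p)))
      - (\<Sum>k=1..<n. 1 / real k) / real n - 1 / (2 * real n ^ 2)"
proof -
  let ?S = "\<lambda>i. \<Sum>p=1..i. 1 / real (n + p)"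
  have split: "{1..n} = insert n {1..<n}" using assms by auto
  have "1 / real k * (\<Sum>l=1..<k. 1 / real (n + l)) =
      1 / real k * ?S k - 1 / real n * (1 / real k - 1 / real (n + k))"
    if "k \<in> {1..<n}" for k
  proof -
    have "{1..k} = insert k {1..<k}" using that by auto
    hence "?S k = (\<Sum>l=1..<k. 1 / real (n + l)) + 1 / real (n + k)" by simp
    moreover have "1 / real k * (1 / real (n + k)) = 1 / real n * (1 / real k - 1 / real (n + k))"
      using that by (simp add: field_simps)
    ultimately show ?thesis by (simp add: algebra_simps)
  qed
  hence "(\<Sum>k=1..<n. 1 / real k * (\<Sum>l=1..<k. 1 / real (n + l))) =
      (\<Sum>k=1..<n. 1 / real k * ?S k)
        - 1 / real n * ((\<Sum>k=1..<n. 1 / real k) - (\<Sum>k=1..<n. 1 / real (n + k)))"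
    unfolding sum_distrib_left[of "1 / real n"] sum_subtractf[symmetric] by (intro sum.cong refl)
  also have "(\<Sum>k=1..<n. 1 / real k * ?S k) = (\<Sum>k=1..n. 1 / real k * ?S k) - 1 / real n * ?S n"
    by (subst split) simp
  also have "(\<Sum>k=1..<n. 1 / real (n + k)) = ?S n - 1 / (2 * real n)"
    unfolding split by simp
  finally show ?thesis
    using assms by (simp add: right_diff_distrib power2_eq_square)
qed

section \<open>Telescoping, iterated sums and summability\<close>

lemma has_sum_inverse_mult_shift:
  assumes "n > 0"
  shows "((\<lambda>m. 1 / (real m * real (m + n))) has_sum (1 / real n * (\<Sum>i=1..n. 1 / real (k + i)))) {k<..}"
proof -
  \<comment> \<open>By partial fractions the summand is this difference divided by \<open>n\<close>.
    Raising \<open>n\<close> by one adds a series of consecutive differences, which telescopes to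
    its first term \<open>1 / (k + n + 1)\<close>.\<close>
  have "(\<lambda>j. 1 / real (j + Suc k) - 1 / real (j + Suc k + n)) sums (\<Sum>i=1..n. 1 / real (k + i))"
  proof (induction n)
    case (Suc n)
    have "(\<lambda>j. 1 / real (j + Suc k + n)) \<longlonglongrightarrow> 0"
      using LIMSEQ_ignore_initial_segment[OF lim_1_over_n[where 'a=real], of "Suc k + n"]
      by (simp add: add_ac)
    hence "(\<lambda>j. 1 / real (j + Suc k + n) - 1 / real (Suc j + Suc k + n)) sums (1 / real (0 + Suc k + n) - 0)"
      by (rule telescope_sums')
    from sums_add[OF Suc this] show ?case
      by (simp add: add_ac)
  qed auto
  hence "(\<lambda>j. 1 / real n * (1 / real (j + Suc k) - 1 / real (j + Suc k + n)))
           sums (1 / real n * (\<Sum>i=1..n. 1 / real (k + i)))"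
    by (rule sums_mult)
  also have "(\<lambda>j. 1 / real n * (1 / real (j + Suc k) - 1 / real (j + Suc k + n))) =
      (\<lambda>j. 1 / (real (j + Suc k) * real (j + Suc k + n)))"
    using assms by (intro ext) (simp add: field_simps)
  finally have "((\<lambda>j. 1 / (real (j + Suc k) * real (j + Suc k + n)))
      has_sum (1 / real n * (\<Sum>i=1..n. 1 / real (k + i)))) UNIV"
    by (rule sums_nonneg_imp_has_sum) simp
  thus ?thesis
    by (subst has_sum_reindex_bij_witness[where T = UNIV and j = "\<lambda>m. m - Suc k" and i = "\<lambda>j. j + Suc k"
          and h = "\<lambda>j. 1 / (real (j + Suc k) * real (j + Suc k + n))"]) auto
qed

text \<open>Convergent iterated sums alone do not give unordered summability over the pairs;
  nonnegativity of the terms does.\<close>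

lemma has_sum_SigmaI_nonneg:
  fixes f :: "'a \<times> 'b \<Rightarrow> real"
  assumes "\<And>x. x \<in> A \<Longrightarrow> ((\<lambda>y. f (x, y)) has_sum g x) (B x)"
    and "(g has_sum S) A"
    and "\<And>x y. x \<in> A \<Longrightarrow> y \<in> B x \<Longrightarrow> f (x, y) \<ge> 0"
  shows "(f has_sum S) (Sigma A B)"
  using assms by (intro has_sum_SigmaI[OF assms(1,2)] summable_on_SigmaI[where g = g])
    (auto dest: has_sum_imp_summable)

lemma summable_on_inverse_power:
  assumes "2 \<le> s"
  shows "(\<lambda>n. 1 / real n ^ s) summable_on A"
proof -
  have "summable (\<lambda>n. norm (1 / real n ^ s))"
    using inverse_power_summable[OF assms, where 'a=real] by (simp add: inverse_eq_divide)
  thus ?thesis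
    by (rule summable_on_subset_banach[OF norm_summable_imp_summable_on subset_UNIV])
qed

text \<open>All inner sums are bounded by the full series of \<open>1 / k^2\<close>. Leaving
  \<open>B\<close> general covers both \<open>{1..n}\<close> and \<open>{1..<n}\<close>.\<close>

lemma summable_on_inverse_power_mult_sum_squares:
  assumes "2 \<le> s" and "\<And>n. finite (B n)"
  shows "(\<lambda>n. 1 / real n ^ s * (\<Sum>k\<in>B n. 1 / real k ^ 2)) summable_on A"
proof (rule summable_on_comparison_test)
  let ?C = "\<Sum>\<^sub>\<infinity>k. 1 / real k ^ 2"
  show "(\<lambda>n. 1 / real n ^ s * ?C) summable_on A"
    by (intro summable_on_cmult_left summable_on_inverse_power assms)
  show "1 / real n ^ s * (\<Sum>k\<in>B n. 1 / real k ^ 2) \<le> 1 / real n ^ s * ?C" for n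
    by (intro mult_left_mono finite_sum_le_infsum summable_on_inverse_power assms) auto
qed (auto intro!: sum_nonneg divide_nonneg_nonneg)

section \<open>Multiple zeta values of depth at most three, indexed by tuples instead of
  lists\<close>

abbreviation decreasing_triples :: "(nat \<times> nat \<times> nat) set" where
  "decreasing_triples \<equiv> {(m, k, l). 0 < l \<and> l < k \<and> k < m}"

lemma mzv_depth_1: "mzv [a] = (\<Sum>\<^sub>\<infinity>n\<in>{0<..}. 1 / real n ^ a)"
  unfolding mzv_def
  by (rule infsum_reindex_bij_witness[where j = "\<lambda>k. k ! 0" and i = "\<lambda>n. [n]"])
    (auto simp: length_Suc_conv)

lemma mzv_depth_2:
  "mzv [a, b] = (\<Sum>\<^sub>\<infinity>(m, n)\<in>Sigma {0<..} (\<lambda>m. {1..<m}). 1 / real m ^ a * (1 / real n ^ b))"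
  unfolding mzv_def
  by (rule infsum_reindex_bij_witness[where j = "\<lambda>k. (k ! 0, k ! 1)" and i = "\<lambda>(m, n). [m, n]"])
    (auto simp: length_Suc_conv lessThan_Suc)

lemma mzv_depth_3:
  "mzv [a, b, c] =
     (\<Sum>\<^sub>\<infinity>(m, k, l)\<in>decreasing_triples. 1 / real m ^ a * (1 / real k ^ b) * (1 / real l ^ c))"
  unfolding mzv_def
  by (rule infsum_reindex_bij_witness[where j = "\<lambda>k. (k ! 0, k ! 1, k ! 2)" and i = "\<lambda>(m, k, l). [m, k, l]"])
    (auto simp: length_Suc_conv lessThan_Suc numeral_2_eq_2)

text \<open>Since \<open>mzv\<close> is an \<open>infsum\<close>, its value is meaningful only once
  convergence is known. The inner sums are finite and the terms nonnegative, so summability over the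
  larger index suffices.\<close>

lemma has_sum_mzv_depth_2:
  assumes "(\<lambda>m. 1 / real m ^ a * (\<Sum>n=1..<m. 1 / real n ^ b)) summable_on {0<..}"
  shows "((\<lambda>m. 1 / real m ^ a * (\<Sum>n=1..<m. 1 / real n ^ b)) has_sum mzv [a, b]) {0<..}"
proof -
  let ?g = "\<lambda>m. 1 / real m ^ a * (\<Sum>n=1..<m. 1 / real n ^ b)"
  have "((\<lambda>(m, n). 1 / real m ^ a * (1 / real n ^ b)) has_sum infsum ?g {0<..})
      (Sigma {0<..} (\<lambda>m. {1..<m}))"
    by (rule has_sum_SigmaI_nonneg[where g = ?g])
      (use assms in \<open>auto simp: sum_distrib_left intro!: has_sum_finiteI\<close>)
  hence "mzv [a, b] = infsum ?g {0<..}"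
    unfolding mzv_depth_2 by (rule infsumI)
  thus ?thesis using assms by simp
qed

section \<open>Reduction of the two triple series to single series\<close>

lemma has_sum_sum:
  fixes f :: "'i \<Rightarrow> 'a \<Rightarrow> real"
  assumes "\<And>i. i \<in> I \<Longrightarrow> (f i has_sum g i) A"
  shows "((\<lambda>x. \<Sum>i\<in>I. f i x) has_sum (\<Sum>i\<in>I. g i)) A"
  using assms by (induction I rule: infinite_finite_induct) (auto intro!: has_sum_add)

text \<open>The outer variable is the smallest index \<open>l\<close>. Summing over
  \<open>m > k\<close> with shift \<open>l\<close> produces a finite sum over \<open>p\<close> of
  \<open>1 / (k (k + p))\<close>; summing this over \<open>k > l\<close> is the same telescoping
  series, now with shift \<open>p\<close> and lower bound \<open>l\<close>.\<close>

lemma has_sum_triples_outer_small: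
  assumes "q \<ge> 1"
  defines "g \<equiv> \<lambda>n. 1 / real n ^ Suc q * (\<Sum>i=1..n. 1 / real i * (\<Sum>p=1..i. 1 / real (n + p)))"
  shows "g summable_on {0<..}"
    and "((\<lambda>(m, k, l). 1 / (real k * real m * real (m + l) * real l ^ q)) has_sum infsum g {0<..})
           decreasing_triples"
proof -
  \<comment> \<open>The closed form of the triangular sum shows that it is bounded in
    \<open>n\<close>, and \<open>Suc q >= 2\<close>.\<close>
  have "g = (\<lambda>n. 1 / real n ^ Suc q * (\<Sum>k=1..n. 1 / real k ^ 2) * (1 / 2))"
    unfolding g_def sum_triangle_eq_half_sum_squares by simp
  thus summable: "g summable_on {0<..}"
    using assms(1)
    by (simp only:) (intro summable_on_cmult_left summable_on_inverse_power_mult_sum_squares, auto)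
  let ?f = "\<lambda>(l, k, m). 1 / (real k * real m * real (m + l) * real l ^ q)"
  let ?g2 = "\<lambda>l k. 1 / real l ^ Suc q * (\<Sum>p=1..l. 1 / (real k * real (k + p)))"
  have inner: "((\<lambda>m. ?f (l, k, m)) has_sum ?g2 l k) {k<..}" if "0 < l" for l k
    using has_sum_cmult_right[OF has_sum_inverse_mult_shift[OF that, of k], of "1 / (real k * real l ^ q)"]
    by (simp add: sum_distrib_left mult_ac)
  have middle: "(?g2 l has_sum g l) {l<..}" for l
    unfolding g_def by (intro has_sum_cmult_right has_sum_sum has_sum_inverse_mult_shift) auto
  have "((\<lambda>x. ?f (l, x)) has_sum g l) (Sigma {l<..} (\<lambda>k. {k<..}))" if "0 < l" for l
    by (rule has_sum_SigmaI_nonneg[OF _ middle]) (use inner[OF that] in auto)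
  hence "(?f has_sum infsum g {0<..}) (Sigma {0<..} (\<lambda>l. Sigma {l<..} (\<lambda>k. {k<..})))"
    by (rule has_sum_SigmaI_nonneg[where g = g]) (use summable in auto)
  thus "((\<lambda>(m, k, l). 1 / (real k * real m * real (m + l) * real l ^ q)) has_sum infsum g {0<..})
           decreasing_triples"
    by (subst has_sum_reindex_bij_witness[where T = "Sigma {0<..} (\<lambda>l. Sigma {l<..} (\<lambda>k. {k<..}))"
          and h = ?f and j = "\<lambda>(m, k, l). (l, k, m)" and i = "\<lambda>(l, k, m). (m, k, l)"]) auto
qed

text \<open>Here the outer variable is the largest index \<open>m\<close>, so the sums over
  \<open>k\<close> and \<open>l\<close> are finite. Convergence is shown first on the triples, and
  summability of \<open>g\<close> follows from it.\<close>

lemma has_sum_triples_outer_large: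
  assumes "q \<ge> 1"
  defines "g \<equiv> \<lambda>n. 1 / real n ^ Suc q * (\<Sum>k=1..<n. 1 / real k * (\<Sum>l=1..<k. 1 / real (n + l)))"
  shows "g summable_on {0<..}"
    and "((\<lambda>(m, k, l). 1 / (real k * real m ^ Suc q * real (m + l))) has_sum infsum g {0<..})
           decreasing_triples"
proof -
  let ?f = "\<lambda>(m, k, l). 1 / (real k * real m ^ Suc q * real (m + l))"
  have D: "decreasing_triples = Sigma {0<..} (\<lambda>m. Sigma {1..<m} (\<lambda>k. {1..<k}))"
    by auto
  have "?f summable_on decreasing_triples"
  proof (rule summable_on_comparison_test)
    show "(\<lambda>(m, k, l). 1 / (real k * real m * real (m + l) * real l ^ 1)) summable_on decreasing_triples"
      using has_sum_triples_outer_small(2)[of 1] has_sum_imp_summable by blast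
    fix x assume "x \<in> decreasing_triples"
    then obtain m k l where x: "x = (m, k, l)" and *: "0 < l" "l < k" "k < m" by auto
    \<comment> \<open>Because \<open>l < m <= m^q\<close>, the series of the preceding lemma with
      exponent 1 is a majorant.\<close>
    have "real l \<le> real m ^ q"
      using * assms(1) self_le_power[of "real m" q] by linarith
    hence "real k * real m * real (m + l) * real l \<le> real k * real m * real (m + l) * real m ^ q"
      by (intro mult_left_mono) auto
    hence "1 / (real k * real m ^ Suc q * real (m + l)) \<le> 1 / (real k * real m * real (m + l) * real l)"
      using * by (intro divide_left_mono) (auto simp: mult_ac)
    thus "?f x \<le> (\<lambda>(m, k, l). 1 / (real k * real m * real (m + l) * real l ^ 1)) x"
      using x by simp
  qed auto
  then obtain S where f: "(?f has_sum S) decreasing_triples" by (auto simp: summable_on_def)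
  have "(g has_sum S) {0<..}"
  proof (rule has_sum_SigmaD[OF f[unfolded D]])
    fix m :: nat
    show "((\<lambda>y. ?f (m, y)) has_sum g m) (Sigma {1..<m} (\<lambda>k. {1..<k}))"
      unfolding g_def
      by (rule has_sum_finiteI) (auto simp: sum.Sigma[symmetric] sum_distrib_left mult_ac intro!: sum.cong)
  qed
  thus "g summable_on {0<..}"
    and "((\<lambda>(m, k, l). 1 / (real k * real m ^ Suc q * real (m + l))) has_sum infsum g {0<..})
           decreasing_triples"
    using f by (auto simp: has_sum_iff)
qed

text \<open>The worst exponents are \<open>2, 1, 1\<close>. There \<open>m + l <= 2 m\<close> bounds
  \<open>1 / (m^2 k l)\<close> by twice the term of the first triple series with
  \<open>q = 1\<close>, whose convergence is already established.\<close>

lemma summable_on_mzv_depth_3: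
  assumes "2 \<le> a" "1 \<le> b" "1 \<le> c"
  shows "(\<lambda>(m, k, l). 1 / real m ^ a * (1 / real k ^ b) * (1 / real l ^ c))
           summable_on decreasing_triples"
proof (rule summable_on_comparison_test)
  let ?h = "\<lambda>(m, k, l). 1 / (real k * real m * real (m + l) * real l ^ 1) * 2"
  have "(\<lambda>x. (\<lambda>(m, k, l). 1 / (real k * real m * real (m + l) * real l ^ 1)) x * 2)
          summable_on decreasing_triples"
    using has_sum_triples_outer_small(2)[of 1] has_sum_imp_summable
    by (intro summable_on_cmult_left) blast
  thus "?h summable_on decreasing_triples" by (simp add: case_prod_unfold)
  fix x assume "x \<in> decreasing_triples"
  then obtain m k l where x: "x = (m, k, l)" and *: "0 < l" "l < k" "k < m" by auto
  have pow: "1 / real n ^ s \<le> 1 / real n ^ t" if "t \<le> s" "0 < n" for n s t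
    using that by (intro divide_left_mono power_increasing) auto
  have "1 / real m ^ a * (1 / real k ^ b) * (1 / real l ^ c)
      \<le> 1 / real m ^ 2 * (1 / real k ^ 1) * (1 / real l ^ 1)"
    using assms * by (intro mult_mono pow) auto
  also have "\<dots> = 1 / (real k * real m * real (2 * m) * real l) * 2"
    by (simp add: power2_eq_square)
  also have "\<dots> \<le> 1 / (real k * real m * real (m + l) * real l) * 2"
    using * by (intro mult_right_mono divide_left_mono mult_left_mono) auto
  finally show "(\<lambda>(m, k, l). 1 / real m ^ a * (1 / real k ^ b) * (1 / real l ^ c)) x \<le> ?h x"
    using x by simp
qed auto

section \<open>The alternating sum over \<open>a\<close> and \<open>c\<close> for a single
  triple\<close>

lemma alternating_geometric_sum:
  fixes x y :: real
  assumes "odd q" "x + y \<noteq> 0"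
  shows "(\<Sum>(a, c) | a + c = q + 2 \<and> 2 \<le> a \<and> 1 \<le> c. (-1) ^ a * (x ^ a * y ^ c)) =
    x ^ 2 * y * (x ^ q + y ^ q) / (x + y)"
proof -
  have "(\<Sum>(a, c) | a + c = q + 2 \<and> 2 \<le> a \<and> 1 \<le> c. (-1) ^ a * (x ^ a * y ^ c)) =
      (\<Sum>i<q. x ^ 2 * y * (y ^ (q - Suc i) * (- x) ^ i))"
  proof (rule sum.reindex_bij_witness[where i = "\<lambda>i. (i + 2, q - i)" and j = "\<lambda>(a, c). a - 2"], goal_cases)
    case (5 z)
    then obtain a c where z: "z = (a, c)" and ac: "a + c = q + 2" "2 \<le> a" "1 \<le> c" by auto
    define i where "i = a - 2"
    have "a = i + 2" "c = Suc (q - Suc i)" using ac by (auto simp: i_def)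
    thus ?case
      unfolding z by (simp add: power_add power_minus[of x i] power2_eq_square mult_ac)
  qed auto
  also have "\<dots> = x ^ 2 * y * (\<Sum>i<q. y ^ (q - Suc i) * (- x) ^ i)"
    by (simp add: sum_distrib_left)
  \<comment> \<open>The sum is the cofactor of \<open>- x - y\<close> in
    \<open>(- x)^q - y^q\<close>; oddness of \<open>q\<close> turns that difference into
    \<open>- (x^q + y^q)\<close>.\<close>
  also have "(\<Sum>i<q. y ^ (q - Suc i) * (- x) ^ i) = (x ^ q + y ^ q) / (x + y)"
    using power_diff_sumr2[of "- x" q y] assms by (simp add: field_simps)
  finally show ?thesis by simp
qed

text \<open>With \<open>x = 1 / m\<close> and \<open>y = 1 / l\<close> the prefactor
  \<open>x^2 y / (x + y)\<close> becomes \<open>1 / (m (m + l))\<close>; then \<open>y^q\<close>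
  yields the first part and \<open>x^q\<close> the second.\<close>

lemma alternating_sum_triple_term:
  assumes "odd q" "0 < m" "0 < l"
  shows "(\<Sum>(a, c) | a + c = q + 2 \<and> 2 \<le> a \<and> 1 \<le> c.
      (-1) ^ a * (1 / real m ^ a * (1 / real k ^ 1) * (1 / real l ^ c))) =
    1 / (real k * real m * real (m + l) * real l ^ q) + 1 / (real k * real m ^ Suc q * real (m + l))"
proof -
  let ?x = "1 / real m" and ?y = "1 / real l"
  have pos: "?x + ?y > 0" using assms by (intro add_pos_pos) auto
  have "(\<Sum>(a, c) | a + c = q + 2 \<and> 2 \<le> a \<and> 1 \<le> c.
      (-1) ^ a * (1 / real m ^ a * (1 / real k ^ 1) * (1 / real l ^ c))) =
    (\<Sum>(a, c) | a + c = q + 2 \<and> 2 \<le> a \<and> 1 \<le> c. (-1) ^ a * (?x ^ a * ?y ^ c)) * (1 / real k)"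
    by (simp add: sum_divide_distrib case_prod_unfold power_one_over mult_ac)
  also have "\<dots> = ?x ^ 2 * ?y * (?x ^ q + ?y ^ q) / (?x + ?y) * (1 / real k)"
    using alternating_geometric_sum[OF assms(1), of ?x ?y] pos by simp
  also have "?x + ?y = real (m + l) / (real m * real l)"
    using assms by (simp add: field_simps)
  also have "?x ^ 2 * ?y * (?x ^ q + ?y ^ q) / (real (m + l) / (real m * real l)) * (1 / real k) =
      (?x ^ q + ?y ^ q) / (real k * real m * real (m + l))"
    using assms by (simp add: power2_eq_square mult_ac)
  also have "\<dots> = 1 / (real k * real m * real (m + l) * real l ^ q) + 1 / (real k * real m ^ Suc q * real (m + l))"
    by (simp add: add_divide_distrib power_one_over mult_ac)
  finally show ?thesis .
qed

text \<open>The crude bound of the harmonic sum by \<open>n\<close> lowers the exponent by one,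
  hence the requirement \<open>3 <= s\<close>.\<close>

lemma summable_on_inverse_power_mult_harmonic:
  assumes "3 \<le> s"
  shows "(\<lambda>n. 1 / real n ^ s * (\<Sum>k=1..<n. 1 / real k ^ 1)) summable_on {0<..}"
proof (rule summable_on_comparison_test)
  show "(\<lambda>n. 1 / real n ^ (s - 1)) summable_on {0<..}"
    using assms by (intro summable_on_inverse_power) auto
  fix n :: nat assume "n \<in> {0<..}"
  have "(\<Sum>k=1..<n. 1 / real k ^ 1) \<le> (\<Sum>k=1..<n. 1)"
    by (intro sum_mono) auto
  also have "\<dots> \<le> real n" by simp
  finally have "1 / real n ^ s * (\<Sum>k=1..<n. 1 / real k ^ 1) \<le> 1 / real n ^ s * real n"
    by (intro mult_left_mono) auto
  also have "\<dots> = 1 / real n ^ (s - 1)"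
    using assms \<open>n \<in> {0<..}\<close> by (cases s) auto
  finally show "1 / real n ^ s * (\<Sum>k=1..<n. 1 / real k ^ 1) \<le> 1 / real n ^ (s - 1)" .
qed (auto intro!: sum_nonneg divide_nonneg_nonneg)

theorem theorem5p3:
  fixes w u v :: nat
  assumes "4 \<le> w" and "even w" and "u = w - 2" and "v = w - 1"
  shows "(\<Sum>(a, c) | a + c = w - 1 \<and> 2 \<le> a \<and> 1 \<le> c. (-1) ^ a * mzv [a, 1, c])
           = mzv [u, 2] - mzv [v, 1] + 1 / 2 * mzv [w]"
proof -
  \<comment> \<open>This \<open>q\<close> is the number of admissible pairs \<open>(a, c)\<close>;
    it is odd because \<open>w\<close> is even.\<close>
  define q where "q = w - 3"
  have w: "w = q + 3" "u = Suc q" "v = q + 2" "w - 1 = q + 2" and q: "1 \<le> q" "odd q"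
    using assms by (auto simp: q_def)
  let ?I = "{(a, c). a + c = q + 2 \<and> 2 \<le> a \<and> 1 \<le> c}"
  let ?t = "\<lambda>a c. \<lambda>(m, k, l). 1 / real m ^ a * (1 / real k ^ 1) * (1 / real l ^ c)"
  define G where "G n = (\<Sum>i=1..n. 1 / real i * (\<Sum>p=1..i. 1 / real (n + p)))" for n
  define T where "T n = (\<Sum>k=1..<n. 1 / real k * (\<Sum>l=1..<k. 1 / real (n + l)))" for n
  have "((\<lambda>x. \<Sum>z\<in>?I. (\<lambda>(a, c). (-1) ^ a * ?t a c x) z) has_sum
      (\<Sum>z\<in>?I. (\<lambda>(a, c). (-1) ^ a * mzv [a, 1, c]) z)) decreasing_triples"
  proof (rule has_sum_sum, clarify)
    fix a c :: nat assume "2 \<le> a" "1 \<le> c"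
    hence "(?t a c has_sum mzv [a, 1, c]) decreasing_triples"
      unfolding mzv_depth_3 by (intro has_sum_infsum summable_on_mzv_depth_3) auto
    thus "((\<lambda>x. (-1) ^ a * ?t a c x) has_sum ((-1) ^ a * mzv [a, 1, c])) decreasing_triples"
      by (rule has_sum_cmult_right)
  qed
  \<comment> \<open>The same function on triples is summed a second way, after adding up the pairs
    \<open>(a, c)\<close> pointwise; uniqueness of the sum then equates the two values.\<close>
  moreover have "((\<lambda>x. \<Sum>z\<in>?I. (\<lambda>(a, c). (-1) ^ a * ?t a c x) z) has_sum
      (infsum (\<lambda>n. 1 / real n ^ Suc q * G n) {0<..} + infsum (\<lambda>n. 1 / real n ^ Suc q * T n) {0<..}))
      decreasing_triples"
    using has_sum_add[OF has_sum_triples_outer_small(2)[OF q(1)] has_sum_triples_outer_large(2)[OF q(1)]]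
    unfolding G_def T_def
    by (rule has_sum_cong[THEN iffD1, rotated])
      (auto simp: alternating_sum_triple_term[OF q(2), simplified])
  ultimately have lhs: "(\<Sum>(a, c)\<in>?I. (-1) ^ a * mzv [a, 1, c]) =
      infsum (\<lambda>n. 1 / real n ^ Suc q * G n) {0<..} + infsum (\<lambda>n. 1 / real n ^ Suc q * T n) {0<..}"
    by (rule has_sum_unique)
  have GT: "((\<lambda>n. 1 / real n ^ Suc q * G n + 1 / real n ^ Suc q * T n) has_sum
      (\<Sum>(a, c)\<in>?I. (-1) ^ a * mzv [a, 1, c])) {0<..}"
    unfolding lhs G_def T_def
    by (intro has_sum_add has_sum_infsum has_sum_triples_outer_small(1) has_sum_triples_outer_large(1) q(1))
  \<comment> \<open>The right-hand side as one series over the largest index; the subtraction is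
    written as a multiple by \<open>- 1\<close> so that the rules for sums and scalar multiples
    apply.\<close>
  have "((\<lambda>n. 1 / real n ^ u * (\<Sum>k=1..<n. 1 / real k ^ 2)
          + (- 1) * (1 / real n ^ v * (\<Sum>k=1..<n. 1 / real k ^ 1)) + 1 / 2 * (1 / real n ^ w)) has_sum
      (mzv [u, 2] + (- 1) * mzv [v, 1] + 1 / 2 * mzv [w])) {0<..}"
  proof (intro has_sum_add has_sum_cmult_right has_sum_mzv_depth_2)
    show "(\<lambda>n. 1 / real n ^ u * (\<Sum>k=1..<n. 1 / real k ^ 2)) summable_on {0<..}"
      using w q by (intro summable_on_inverse_power_mult_sum_squares) auto
    show "(\<lambda>n. 1 / real n ^ v * (\<Sum>k=1..<n. 1 / real k ^ 1)) summable_on {0<..}"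
      using w q by (intro summable_on_inverse_power_mult_harmonic) auto
    show "((\<lambda>n. 1 / real n ^ w) has_sum mzv [w]) {0<..}"
      unfolding mzv_depth_1 using w by (intro has_sum_infsum summable_on_inverse_power) auto
  qed
  moreover have "1 / real n ^ u * (\<Sum>k=1..<n. 1 / real k ^ 2)
          + (- 1) * (1 / real n ^ v * (\<Sum>k=1..<n. 1 / real k ^ 1)) + 1 / 2 * (1 / real n ^ w)
        = 1 / real n ^ Suc q * G n + 1 / real n ^ Suc q * T n" if "n \<in> {0<..}" for n
  proof -
    have n: "n > 0" using that by simp
    hence "{1..n} = insert n {1..<n}" by auto
    \<comment> \<open>Since \<open>T n\<close> is \<open>G n\<close> minus corrections,
      \<open>G n + T n\<close> involves \<open>2 * G n\<close>, which removes the factor one half.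
      The term \<open>k = n\<close> gives \<open>1 / n^2\<close>; less the correction
      \<open>1 / (2 n^2)\<close>, it leaves the coefficient one half of
      \<open>mzv [w]\<close>.\<close>
    hence "2 * G n = (\<Sum>k=1..<n. 1 / real k ^ 2) + 1 / real n ^ 2"
      unfolding G_def sum_triangle_eq_half_sum_squares by simp
    moreover have "T n = G n - (\<Sum>k=1..<n. 1 / real k) / real n - 1 / (2 * real n ^ 2)"
      unfolding G_def T_def by (rule sum_strict_triangle[OF n])
    ultimately have "G n + T n = (\<Sum>k=1..<n. 1 / real k ^ 2) - (\<Sum>k=1..<n. 1 / real k) / real n
        + 1 / (2 * real n ^ 2)"
      by simp
    hence "1 / real n ^ Suc q * G n + 1 / real n ^ Suc q * T n = 1 / real n ^ Suc q *
      ((\<Sum>k=1..<n. 1 / real k ^ 2) - (\<Sum>k=1..<n. 1 / real k) / real n + 1 / (2 * real n ^ 2))"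
      by (metis distrib_left)
    also have "\<dots> = 1 / real n ^ u * (\<Sum>k=1..<n. 1 / real k ^ 2)
          + (- 1) * (1 / real n ^ v * (\<Sum>k=1..<n. 1 / real k ^ 1)) + 1 / 2 * (1 / real n ^ w)"
      unfolding w by (simp add: algebra_simps power_add power2_eq_square power3_eq_cube)
    finally show ?thesis by simp
  qed
  ultimately have "((\<lambda>n. 1 / real n ^ Suc q * G n + 1 / real n ^ Suc q * T n) has_sum
      (mzv [u, 2] + (- 1) * mzv [v, 1] + 1 / 2 * mzv [w])) {0<..}"
    by (subst has_sum_cong[symmetric]) auto
  from has_sum_unique[OF GT this] show ?thesis
    unfolding w(4) by simp
qed

end
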